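(* Let $X$ be a contraction on a separable complex Hilbert space $\mathbb{H}$ and let $T_X$ be the Varopoulos operator of type II and order $2$. If $P$ is an $M_k$-valued polynomial in one variable, of degree at most $n$, with $\sup_{z\in\mathbb{D}}\|P(z)\|_{op}\le 1$, then $\|P(T_X)\|\le 1$.
   Context: For $X\in\mathcal{B}(\mathbb{H})$, the Varopoulos operator of type II and order $2$ is $T_X=\begin{pmatrix}0&X&0\\0&0&X\\0&0&0\end{pmatrix}\in\mathcal{B}(\mathbb{H}\otimes\mathbb{C}^3)$. For $P(z)=\sum_jA_jz^j$ with $A_j\in M_k$ ($k\times k$ complex matrices), $P(T_X)=\sum_jA_j\otimes T_X^j$. $\mathbb{D}$ is the open unit disc. *)

theory Defs
  imports "HOL-Analysis.Analysis" "HOL-Computational_Algebra.Polynomial"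
begin

(* Complex inner product spaces.  The inner product is linear in its first argument; scaleC extends
   the real scalar multiplication, and cinner_self ties the inner product to the given norm (and
   contains positive definiteness). *)
class complex_inner = real_normed_vector +
  fixes scaleC :: "complex \<Rightarrow> 'a \<Rightarrow> 'a" (infixr "*\<^sub>C" 75)
    and cinner :: "'a \<Rightarrow> 'a \<Rightarrow> complex"
  assumes scaleC_of_real: "complex_of_real r *\<^sub>C x = r *\<^sub>R x"
    and scaleC_add_right: "a *\<^sub>C (x + y) = a *\<^sub>C x + a *\<^sub>C y"
    and scaleC_add_left: "(a + b) *\<^sub>C x = a *\<^sub>C x + b *\<^sub>C x"
    and scaleC_scaleC: "a *\<^sub>C (b *\<^sub>C x) = (a * b) *\<^sub>C x"
    and cinner_commute: "cinner y x = cnj (cinner x y)"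
    and cinner_add_left: "cinner (x + y) z = cinner x z + cinner y z"
    and cinner_scaleC_left: "cinner (a *\<^sub>C x) y = a * cinner x y"
    and cinner_self: "cinner x x = complex_of_real ((norm x)\<^sup>2)"

class complex_hilbert_space = complex_inner + complete_space

instantiation complex :: complex_hilbert_space
begin
definition scaleC_complex :: "complex \<Rightarrow> complex \<Rightarrow> complex"
  where "scaleC_complex a x = a * x"
definition cinner_complex :: "complex \<Rightarrow> complex \<Rightarrow> complex"
  where "cinner_complex x y = x * cnj y"
instance
  by standard
    (auto simp: scaleC_complex_def cinner_complex_def algebra_simps scaleR_conv_of_real
      complex_mult_cnj cmod_power2 simp flip: complex_norm_square)
end

(* The norm of the library type 'a ^ 'n is the l2 norm of the norms of the components, so for a
   Hilbert space 'h the type 'h ^ 'n is the Hilbert space tensor product of 'h with C^n. *)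
instantiation vec :: (complex_inner, finite) complex_inner
begin
definition scaleC_vec :: "complex \<Rightarrow> 'a ^ 'b \<Rightarrow> 'a ^ 'b"
  where "scaleC_vec a x = (\<chi> i. a *\<^sub>C (x $ i))"
definition cinner_vec :: "'a ^ 'b \<Rightarrow> 'a ^ 'b \<Rightarrow> complex"
  where "cinner_vec x y = (\<Sum>i\<in>UNIV. cinner (x $ i) (y $ i))"
instance
proof
  fix x y z :: "'a ^ 'b" and a b :: complex and r :: real
  show "complex_of_real r *\<^sub>C x = r *\<^sub>R x"
    by (simp add: scaleC_vec_def vec_eq_iff scaleC_of_real)
  show "a *\<^sub>C (x + y) = a *\<^sub>C x + a *\<^sub>C y"
    by (simp add: scaleC_vec_def vec_eq_iff scaleC_add_right)
  show "(a + b) *\<^sub>C x = a *\<^sub>C x + b *\<^sub>C x"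
    by (simp add: scaleC_vec_def vec_eq_iff scaleC_add_left)
  show "a *\<^sub>C (b *\<^sub>C x) = (a * b) *\<^sub>C x"
    by (simp add: scaleC_vec_def vec_eq_iff scaleC_scaleC)
  show "cinner y x = cnj (cinner x y)"
    unfolding cinner_vec_def cnj_sum by (rule sum.cong) (auto intro: cinner_commute)
  show "cinner (x + y) z = cinner x z + cinner y z"
    by (simp add: cinner_vec_def cinner_add_left sum.distrib)
  show "cinner (a *\<^sub>C x) y = a * cinner x y"
    by (simp add: cinner_vec_def scaleC_vec_def cinner_scaleC_left sum_distrib_left)
  show "cinner x x = complex_of_real ((norm x)\<^sup>2)"
    by (simp add: cinner_vec_def cinner_self norm_vec_def L2_set_def real_sqrt_pow2 sum_nonneg)
qed
end

instance vec :: (complex_hilbert_space, finite) complex_hilbert_space ..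

definition bounded_clinear :: "('a::complex_inner \<Rightarrow> 'b::complex_inner) \<Rightarrow> bool"
  where "bounded_clinear f \<longleftrightarrow> bounded_linear f \<and> (\<forall>c x. f (c *\<^sub>C x) = c *\<^sub>C f x)"

(* The block matrix (0 X 0; 0 0 X; 0 0 0) acting on column vectors. *)
definition varopoulos_op :: "('h::complex_inner \<Rightarrow> 'h) \<Rightarrow> 'h ^ 3 \<Rightarrow> 'h ^ 3"
  where "varopoulos_op X v = vector [X (v $ 2), X (v $ 3), 0]"

(* A (x) S for a k x k matrix A, acting on the tensor product of C^k with 'v, that is on 'v ^ 'k. *)
definition mat_tensor :: "complex ^ 'k ^ 'k \<Rightarrow> ('v::complex_inner \<Rightarrow> 'v) \<Rightarrow> 'v ^ 'k \<Rightarrow> 'v ^ 'k"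
  where "mat_tensor A S y = (\<chi> i. \<Sum>l\<in>UNIV. A $ i $ l *\<^sub>C S (y $ l))"

(* M_k-valued polynomials are elements of (complex ^ 'k ^ 'k) poly; only coeff and degree are used,
   never the ring structure on poly, which would come from the entrywise product on vec. *)
definition mpoly_eval :: "(complex ^ 'k ^ 'k) poly \<Rightarrow> complex \<Rightarrow> complex ^ 'k ^ 'k"
  where "mpoly_eval P z = (\<Sum>j\<le>degree P. z ^ j *\<^sub>C coeff P j)"

definition mpoly_op ::
  "(complex ^ 'k ^ 'k) poly \<Rightarrow> ('v::complex_inner \<Rightarrow> 'v) \<Rightarrow> 'v ^ 'k \<Rightarrow> 'v ^ 'k"
  where "mpoly_op P T y = (\<Sum>j\<le>degree P. mat_tensor (coeff P j) (T ^^ j) y)"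

definition mat_opnorm :: "complex ^ 'k ^ 'k \<Rightarrow> real"
  where "mat_opnorm A = onorm (\<lambda>v. A *v v)"

(* The lemmas below show that the operators involved are bounded, so that onorm and the real-valued
   supremum over the disc have their usual meaning. *)

lemma norm_scaleC: "norm (a *\<^sub>C (x::'a::complex_inner)) = cmod a * norm x"
proof -
  have "complex_of_real ((norm (a *\<^sub>C x))\<^sup>2) = a * cnj (cinner (a *\<^sub>C x) x)"
    by (metis cinner_self cinner_scaleC_left cinner_commute)
  also have "\<dots> = complex_of_real ((cmod a * norm x)\<^sup>2)"
    by (simp add: cinner_scaleC_left cinner_self power_mult_distrib flip: complex_norm_square)
  finally show ?thesis
    by (metis of_real_eq_iff power2_eq_imp_eq norm_ge_zero mult_nonneg_nonneg)
qed

lemma bounded_linear_vecI: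
  fixes f :: "'a::real_normed_vector \<Rightarrow> 'b::real_normed_vector ^ 'n"
  assumes "\<And>i. bounded_linear (\<lambda>x. f x $ i)"
  shows "bounded_linear f"
proof -
  have "\<exists>K. \<forall>x. norm (f x $ i) \<le> norm x * K" for i
    using bounded_linear.bounded[OF assms] by blast
  then obtain K where K: "\<And>i x. norm (f x $ i) \<le> norm x * K i" by metis
  show ?thesis
  proof (rule bounded_linear_intro[where K = "sum K UNIV"])
    show "f (x + y) = f x + f y" for x y
      by (simp add: vec_eq_iff linear_add[OF bounded_linear.linear[OF assms]])
    show "f (r *\<^sub>R x) = r *\<^sub>R f x" for r x
      by (simp add: vec_eq_iff linear_scale[OF bounded_linear.linear[OF assms]])
    fix x
    have "norm (f x) \<le> (\<Sum>i\<in>UNIV. norm (f x $ i))"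
      unfolding norm_vec_def by (rule L2_set_le_sum) simp
    also have "\<dots> \<le> norm x * sum K UNIV"
      unfolding sum_distrib_left by (rule sum_mono) (rule K)
    finally show "norm (f x) \<le> norm x * sum K UNIV" .
  qed
qed

lemma bounded_clinear_scaleC: "bounded_clinear (\<lambda>x. a *\<^sub>C (x::'a::complex_inner))"
proof -
  have "a *\<^sub>C (r *\<^sub>R x) = r *\<^sub>R (a *\<^sub>C x)" for r and x :: 'a
    by (metis scaleC_of_real scaleC_scaleC mult.commute)
  then have "bounded_linear (\<lambda>x. a *\<^sub>C (x::'a))"
    by (intro bounded_linear_intro[where K = "cmod a"])
      (simp_all add: scaleC_add_right norm_scaleC)
  then show ?thesis
    by (simp add: bounded_clinear_def scaleC_scaleC mult.commute)
qed

lemma scaleC_zero: "a *\<^sub>C (0::'a::complex_inner) = 0"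
  using norm_scaleC[of a "0::'a"] by simp

lemma scaleC_sum: "a *\<^sub>C (\<Sum>i\<in>I. f i) = (\<Sum>i\<in>I. a *\<^sub>C (f i::'a::complex_inner))"
  by (induction I rule: infinite_finite_induct) (simp_all add: scaleC_zero scaleC_add_right)

lemma bounded_clinear_varopoulos_op:
  assumes "bounded_clinear X"
  shows "bounded_clinear (varopoulos_op X)"
proof -
  have X: "bounded_linear X" and XC: "\<And>c x. X (c *\<^sub>C x) = c *\<^sub>C X x"
    using assms by (auto simp: bounded_clinear_def)
  have "bounded_linear (\<lambda>v. varopoulos_op X v $ i)" for i
    using exhaust_3[of i]
    by (auto simp: varopoulos_op_def intro!: bounded_linear_compose[OF X] bounded_linear_vec_nth)
  then show ?thesis
    unfolding bounded_clinear_def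
    by (auto intro!: bounded_linear_vecI
        simp: vec_eq_iff forall_3 varopoulos_op_def scaleC_vec_def XC scaleC_zero)
qed

lemma bounded_clinear_funpow:
  fixes T :: "'v::complex_inner \<Rightarrow> 'v"
  assumes "bounded_clinear T"
  shows "bounded_clinear (T ^^ j)"
proof (induction j)
  case 0
  have "T ^^ 0 = (\<lambda>x. x)" by (simp add: id_def)
  then show ?case by (simp only: bounded_clinear_def bounded_linear_ident simp_thms)
next
  case (Suc j)
  then show ?case
    using assms by (auto simp: bounded_clinear_def o_def intro: bounded_linear_compose)
qed

lemma bounded_clinear_mat_tensor:
  assumes "bounded_clinear S"
  shows "bounded_clinear (mat_tensor A S)"
proof -
  have S: "bounded_linear S" and SC: "\<And>c x. S (c *\<^sub>C x) = c *\<^sub>C S x"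
    using assms by (auto simp: bounded_clinear_def)
  have C: "bounded_linear (\<lambda>x. a *\<^sub>C (x::'a))" for a
    using bounded_clinear_scaleC by (auto simp: bounded_clinear_def)
  have "bounded_linear (mat_tensor A S)"
    unfolding mat_tensor_def
    by (rule bounded_linear_vecI)
      (auto intro!: bounded_linear_sum bounded_linear_compose[OF C] bounded_linear_compose[OF S]
        bounded_linear_vec_nth)
  then show ?thesis
    by (simp add: bounded_clinear_def mat_tensor_def vec_eq_iff scaleC_vec_def SC scaleC_sum
        scaleC_scaleC mult.commute)
qed

lemma bounded_clinear_mpoly_op:
  assumes "bounded_clinear T"
  shows "bounded_clinear (mpoly_op P T)"
proof -
  have *: "bounded_clinear (mat_tensor (coeff P j) (T ^^ j))" for j
    by (intro bounded_clinear_mat_tensor bounded_clinear_funpow assms)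
  then have "bounded_linear (mpoly_op P T)"
    unfolding mpoly_op_def by (auto simp: bounded_clinear_def intro!: bounded_linear_sum)
  with * show ?thesis
    by (simp add: bounded_clinear_def mpoly_op_def scaleC_sum)
qed

lemma mat_vec_eq_mat_tensor: "A *v v = mat_tensor A id v"
  by (simp add: mat_tensor_def matrix_vector_mult_def scaleC_complex_def)

lemma bounded_linear_mat_vec: "bounded_linear (\<lambda>v. (A :: complex ^ 'k ^ 'k) *v v)"
proof -
  have "bounded_clinear (id :: complex \<Rightarrow> complex)"
    using bounded_linear_ident by (simp add: bounded_clinear_def id_def)
  from bounded_clinear_mat_tensor[OF this, of A] show ?thesis
    by (simp add: mat_vec_eq_mat_tensor bounded_clinear_def)
qed

lemma mat_opnorm_add: "mat_opnorm (A + B) \<le> mat_opnorm A + mat_opnorm B"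
proof -
  have "(\<lambda>v. (A + B) *v v) = (\<lambda>v. A *v v + B *v v)"
    by (simp add: fun_eq_iff matrix_vector_mult_add_rdistrib)
  then show ?thesis
    unfolding mat_opnorm_def
    using onorm_triangle[OF bounded_linear_mat_vec[of A] bounded_linear_mat_vec[of B]] by simp
qed

lemma mat_opnorm_sum: "mat_opnorm (\<Sum>i\<in>I. f i) \<le> (\<Sum>i\<in>I. mat_opnorm (f i))"
proof (induction I rule: infinite_finite_induct)
  case (insert i I)
  then show ?case using mat_opnorm_add[of "f i" "\<Sum>i\<in>I. f i"] by simp
qed (simp_all add: mat_opnorm_def onorm_zero)

lemma mat_opnorm_scaleC_le: "mat_opnorm (a *\<^sub>C A) \<le> cmod a * mat_opnorm A"
proof -
  have "(a *\<^sub>C A) *v v = a *\<^sub>C (A *v v)" for v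
    by (simp add: vec_eq_iff matrix_vector_mult_def scaleC_vec_def scaleC_complex_def
        sum_distrib_left mult.assoc)
  then show ?thesis
    unfolding mat_opnorm_def
    using onorm[OF bounded_linear_mat_vec[of A]]
    by (auto intro!: onorm_le simp: norm_scaleC mult.assoc mult_left_mono)
qed

lemma bdd_above_mat_opnorm_mpoly_eval:
  "bdd_above ((\<lambda>z. mat_opnorm (mpoly_eval P z)) ` ball 0 1)"
proof (rule bdd_aboveI2)
  fix z :: complex assume "z \<in> ball 0 1"
  then have z: "cmod z ^ j \<le> 1" for j by (simp add: power_le_one)
  have "mat_opnorm (mpoly_eval P z) \<le> (\<Sum>j\<le>degree P. mat_opnorm (z ^ j *\<^sub>C coeff P j))"
    unfolding mpoly_eval_def by (rule mat_opnorm_sum)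
  also have "\<dots> \<le> (\<Sum>j\<le>degree P. mat_opnorm (coeff P j))"
  proof (rule sum_mono)
    fix j
    have "mat_opnorm (z ^ j *\<^sub>C coeff P j) \<le> cmod z ^ j * mat_opnorm (coeff P j)"
      using mat_opnorm_scaleC_le[of "z ^ j"] by (simp add: norm_power)
    also have "\<dots> \<le> 1 * mat_opnorm (coeff P j)"
      by (rule mult_right_mono[OF z])
        (simp add: mat_opnorm_def onorm_pos_le bounded_linear_mat_vec)
    finally show "mat_opnorm (z ^ j *\<^sub>C coeff P j) \<le> mat_opnorm (coeff P j)" by simp
  qed
  finally show "mat_opnorm (mpoly_eval P z) \<le> (\<Sum>j\<le>degree P. mat_opnorm (coeff P j))" .
qed

end

theory Submission
  imports Defs
begin

text \<open>
  The operator \<open>T = T\<^sub>X\<close> is a contraction with \<open>T\<^sup>3 = 0\<close>, so the claim is an instance of the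
  matrix-valued von Neumann inequality for a nilpotent contraction
  (\<open>von_neumann_matrix_nilpotent\<close>).  That inequality expresses that \<open>T\<close> is part of a backward
  shift, and the shift satisfies it by Fourier analysis.

  For a contraction \<open>T\<close> the defect form \<open>D(u,v) = \<langle>u,v\<rangle> - \<langle>Tu,Tv\<rangle>\<close> is positive semidefinite.
  If \<open>T\<^sup>M = 0\<close>, telescoping gives \<open>\<parallel>x\<parallel>\<^sup>2 = (\<Sum>s<M. D(T\<^sup>sx, T\<^sup>sx))\<close>.  Hence
  \<open>x \<mapsto> (x, Tx, T\<^sup>2x, \<dots>)\<close> is isometric into finite sequences measured by \<open>D\<close>, and it turns \<open>T\<close>
  into the backward shift.  This replaces the usual unitary dilation, and with it the square root
  of \<open>1 - T\<^sup>*T\<close>.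

  To estimate \<open>P(T)y\<close> only the finitely many vectors \<open>T\<^sup>my\<^sub>l\<close> matter.  Their Gram matrix with
  respect to \<open>D\<close> is a positive semidefinite matrix, so by a Cholesky factorization
  (\<open>psd_matrix_is_gram\<close>) these vectors have finitely many scalar coordinates in which \<open>D\<close> is the
  standard inner product (\<open>defect_coordinates\<close>).  Coordinate by coordinate there remains an
  inequality about vectors \<open>w\<^sub>0, w\<^sub>1, \<dots>\<close> in \<open>\<complex>\<^sup>k\<close>, namely
  \<open>(\<Sum>s. \<parallel>\<Sum>j. A\<^sub>j w\<^bsub>s+j\<^esub>\<parallel>\<^sup>2) \<le> (\<Sum>s. \<parallel>w\<^sub>s\<parallel>\<^sup>2)\<close> (\<open>backward_toeplitz_contractive\<close>).  After
  reversing the order of the \<open>w\<^sub>s\<close> it says that multiplying a \<open>\<complex>\<^sup>k\<close>-valued polynomial by \<open>P\<close> does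
  not increase the sum of the squares of any initial segment of coefficients.  By Parseval's
  identity this follows from \<open>\<parallel>P(z)\<parallel> \<le> 1\<close> on the unit circle, which holds by continuity.
\<close>

section \<open>Cholesky factorization of positive semidefinite matrices\<close>

text \<open>
  Splitting off the index \<open>a\<close> leaves the Schur complement \<open>G x y - G x a * cnj (G y a) / G a a\<close>,
  which is again positive semidefinite: minimizing the quadratic form over the coefficient of \<open>a\<close>
  gives its value.  If \<open>G a a = 0\<close>, positivity forces the whole column of \<open>a\<close> to vanish, and with
  \<open>x / 0 = 0\<close> the same formulas cover this degenerate case.
\<close>

lemma psd_matrix_is_gram:
  fixes G :: "'i \<Rightarrow> 'i \<Rightarrow> complex"
  assumes "finite S"
    and "\<And>x y. x \<in> S \<Longrightarrow> y \<in> S \<Longrightarrow> G y x = cnj (G x y)"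
    and "\<And>c. 0 \<le> Re (\<Sum>x\<in>S. \<Sum>y\<in>S. c x * cnj (c y) * G x y)"
  shows "\<exists>B. \<forall>x\<in>S. \<forall>y\<in>S. G x y = (\<Sum>r\<in>S. B r x * cnj (B r y))"
  using assms
proof (induction S arbitrary: G rule: finite_induct)
  case empty
  then show ?case by simp
next
  case (insert a F)
  note herm = insert.prems(1) and psd = insert.prems(2)
  define g where "g = Re (G a a)"
  have gaa: "G a a = of_real g"
    using herm[of a a] by (simp add: g_def complex_eq_iff)
  have expand: "(\<Sum>x\<in>insert a F. \<Sum>y\<in>insert a F. c x * cnj (c y) * G x y)
      = c a * cnj (c a) * of_real g + cnj (c a) * (\<Sum>x\<in>F. c x * G x a)
        + c a * cnj (\<Sum>x\<in>F. c x * G x a) + (\<Sum>x\<in>F. \<Sum>y\<in>F. c x * cnj (c y) * G x y)" for c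
  proof -
    have "(\<Sum>y\<in>F. c a * cnj (c y) * G a y) = c a * cnj (\<Sum>x\<in>F. c x * G x a)"
      unfolding cnj_sum sum_distrib_left using herm[of a] herm[of _ a]
      by (intro sum.cong) (auto simp: mult_ac)
    moreover have "(\<Sum>x\<in>F. c x * cnj (c a) * G x a) = cnj (c a) * (\<Sum>x\<in>F. c x * G x a)"
      unfolding sum_distrib_left by (intro sum.cong) (auto simp: mult_ac)
    ultimately show ?thesis
      using insert.hyps by (simp add: sum.distrib gaa)
  qed
  have g0: "g \<ge> 0"
  proof -
    have "(\<Sum>x\<in>F. (if x = a then 1 else 0) * G x a) = 0"
      "(\<Sum>x\<in>F. \<Sum>y\<in>F. (if x = a then 1 else 0) * cnj (if y = a then 1 else 0) * G x y) = 0"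
      using insert.hyps by (auto intro!: sum.neutral)
    then show ?thesis
      using psd[of "\<lambda>x. if x = a then 1 else 0"] unfolding expand by simp
  qed
  have col0: "G b a = 0" if "g = 0" "b \<in> F" for b
  proof (rule ccontr)
    assume nz: "G b a \<noteq> 0"
    have ineq: "2 * s * (cmod (G b a))\<^sup>2 \<le> Re (G b b)" for s
    proof -
      \<comment> \<open>On these vectors the form is affine in \<open>s\<close>, because its quadratic term has the factor \<open>G a a = 0\<close>.\<close>
      define c where "c x = (if x = a then - of_real s * G b a else if x = b then 1 else 0)" for x
      have ca: "c a = - of_real s * G b a" by (simp add: c_def)
      have cF: "c x = (if x = b then 1 else 0)" if "x \<in> F" for x
        using that insert.hyps by (auto simp: c_def)
      have "(\<Sum>x\<in>F. c x * G x a) = (\<Sum>x\<in>F. if x = b then G x a else 0)"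
        by (intro sum.cong) (auto simp: cF)
      then have 1: "(\<Sum>x\<in>F. c x * G x a) = G b a"
        using that insert.hyps by simp
      have "(\<Sum>x\<in>F. \<Sum>y\<in>F. c x * cnj (c y) * G x y)
          = (\<Sum>x\<in>F. \<Sum>y\<in>F. if y = b then (if x = b then G x y else 0) else 0)"
        by (intro sum.cong) (auto simp: cF)
      then have 2: "(\<Sum>x\<in>F. \<Sum>y\<in>F. c x * cnj (c y) * G x y) = G b b"
        using that insert.hyps by simp
      show ?thesis
        using psd[of c] \<open>g = 0\<close> unfolding expand 1 2 ca cmod_power2
        by (simp add: algebra_simps power2_eq_square)
    qed
    have "2 * ((Re (G b b) + 1) / (2 * (cmod (G b a))\<^sup>2)) * (cmod (G b a))\<^sup>2 = Re (G b b) + 1"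
      using nz by (simp add: field_simps)
    with ineq[of "(Re (G b b) + 1) / (2 * (cmod (G b a))\<^sup>2)"] show False by linarith
  qed
  define G' where "G' x y = G x y - G x a * cnj (G y a) / of_real g" for x y
  have "\<exists>B. \<forall>x\<in>F. \<forall>y\<in>F. G' x y = (\<Sum>r\<in>F. B r x * cnj (B r y))"
  proof (rule insert.IH)
    show "G' y x = cnj (G' x y)" if "x \<in> F" "y \<in> F" for x y
      using that herm[of x y] by (simp add: G'_def)
    show "0 \<le> Re (\<Sum>x\<in>F. \<Sum>y\<in>F. c x * cnj (c y) * G' x y)" for c
    proof -
      define \<beta> where "\<beta> = (\<Sum>x\<in>F. c x * G x a)"
      \<comment> \<open>This coefficient of \<open>a\<close> minimizes the form when the others are prescribed by \<open>c\<close>.\<close>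
      define c' where "c' = c(a := - \<beta> / of_real g)"
      have cF: "c' x = c x" if "x \<in> F" for x
        using that insert.hyps by (auto simp: c'_def)
      have 1: "(\<Sum>x\<in>F. c' x * G x a) = \<beta>"
        unfolding \<beta>_def by (intro sum.cong) (auto simp: cF)
      have 2: "(\<Sum>x\<in>F. \<Sum>y\<in>F. c' x * cnj (c' y) * G x y)
          = (\<Sum>x\<in>F. \<Sum>y\<in>F. c x * cnj (c y) * G x y)"
        by (intro sum.cong) (auto simp: cF)
      have "(\<Sum>x\<in>F. \<Sum>y\<in>F. c x * cnj (c y) * G' x y)
          = (\<Sum>x\<in>F. \<Sum>y\<in>F. c x * cnj (c y) * G x y) - \<beta> * cnj \<beta> / of_real g"
        unfolding \<beta>_def cnj_sum sum_product
        by (simp add: G'_def algebra_simps sum_subtractf sum_divide_distrib)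
      also have "\<dots> = (\<Sum>x\<in>insert a F. \<Sum>y\<in>insert a F. c' x * cnj (c' y) * G x y)"
        unfolding expand 1 2 by (cases "g = 0") (auto simp: c'_def field_simps)
      finally show ?thesis using psd[of c'] by simp
    qed
  qed
  then obtain B where B: "\<And>x y. x \<in> F \<Longrightarrow> y \<in> F \<Longrightarrow> G' x y = (\<Sum>r\<in>F. B r x * cnj (B r y))"
    by blast
  define B' where "B' r x = (if r = a then G x a / of_real (sqrt g) else if x = a then 0 else B r x)"
    for r x
  have sg: "complex_of_real (sqrt g) * complex_of_real (sqrt g) = of_real g"
    using g0 by (simp flip: of_real_mult)
  have rest: "(\<Sum>r\<in>F. B' r x * cnj (B' r y))
      = (if x = a \<or> y = a then 0 else (\<Sum>r\<in>F. B r x * cnj (B r y)))" for x y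
    using insert.hyps by (auto simp: B'_def intro!: sum.neutral sum.cong)
  have "G x y = (\<Sum>r\<in>insert a F. B' r x * cnj (B' r y))"
    if "x \<in> insert a F" "y \<in> insert a F" for x y
  proof -
    have "(\<Sum>r\<in>insert a F. B' r x * cnj (B' r y))
        = G x a * cnj (G y a) / of_real g + (\<Sum>r\<in>F. B' r x * cnj (B' r y))"
      using insert.hyps by (simp add: B'_def sg)
    also have "\<dots> = G x y"
    proof (cases "x = a \<or> y = a")
      case True
      have "G x a = 0 \<and> G y a = 0" if "g = 0"
        using that col0 gaa \<open>x \<in> insert a F\<close> \<open>y \<in> insert a F\<close> by auto
      then show ?thesis
        unfolding rest using True that gaa herm[of y a] by (cases "g = 0") auto
    next
      case False
      then show ?thesis
        unfolding rest using that B[of x y, symmetric] by (simp add: G'_def)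
    qed
    finally show ?thesis by simp
  qed
  then show ?case by blast
qed

section \<open>Contractive Toeplitz matrices\<close>

lemma parseval_roots_of_unity:
  fixes a :: "nat \<Rightarrow> complex"
  assumes "N > 0"
  defines "\<omega> \<equiv> \<lambda>t. cis (2 * pi * real t / real N)"
  shows "(\<Sum>t<N. (cmod (\<Sum>p<N. \<omega> t ^ p * a p))\<^sup>2) = real N * (\<Sum>p<N. (cmod (a p))\<^sup>2)"
proof -
  have orth: "(\<Sum>t<N. \<omega> t ^ p * cnj (\<omega> t ^ q)) = (if p = q then of_nat N else 0)"
    if "p < N" "q < N" for p q
  proof -
    define \<zeta> where "\<zeta> = \<omega> p * cnj (\<omega> q)"
    have "\<omega> t ^ p = \<omega> p ^ t" for t p
      unfolding \<omega>_def Complex.DeMoivre by (rule arg_cong[of _ _ cis]) simp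
    then have pow: "\<omega> t ^ p * cnj (\<omega> t ^ q) = \<zeta> ^ t" for t
      by (simp add: \<zeta>_def power_mult_distrib)
    show ?thesis
    proof (cases "p = q")
      case True
      then have "\<zeta> = 1" by (simp add: \<zeta>_def \<omega>_def cis_cnj cis_mult)
      then show ?thesis using True pow by simp
    next
      case False
      have "\<omega> p \<noteq> \<omega> q"
        using bij_betw_imp_inj_on[OF Complex.bij_betw_roots_unity[OF \<open>N > 0\<close>]] that False
        by (auto simp: \<omega>_def inj_on_def)
      then have "\<zeta> \<noteq> 1"
        by (auto simp: \<zeta>_def \<omega>_def cis_cnj simp flip: cis_inverse divide_inverse)
      moreover have "\<omega> t ^ N = 1" for t
        using \<open>N > 0\<close> by (simp add: \<omega>_def Complex.DeMoivre)
      then have "\<zeta> ^ N = 1"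
        by (simp add: \<zeta>_def power_mult_distrib flip: complex_cnj_power)
      ultimately show ?thesis
        using pow False by (simp add: sum_gp_strict)
    qed
  qed
  have "complex_of_real (\<Sum>t<N. (cmod (\<Sum>p<N. \<omega> t ^ p * a p))\<^sup>2)
      = (\<Sum>t<N. \<Sum>p<N. \<Sum>q<N. (\<omega> t ^ p * cnj (\<omega> t ^ q)) * (a p * cnj (a q)))"
    unfolding of_real_sum complex_norm_square cnj_sum sum_product
    by (intro sum.cong) (auto simp: mult_ac)
  also have "\<dots> = (\<Sum>p<N. \<Sum>q<N. (\<Sum>t<N. \<omega> t ^ p * cnj (\<omega> t ^ q)) * (a p * cnj (a q)))"
    unfolding sum_distrib_right
    by (rule trans[OF sum.swap sum.cong[OF refl sum.swap]])
  also have "\<dots> = (\<Sum>p<N. \<Sum>q<N. if p = q then of_nat N * (a p * cnj (a q)) else 0)"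
    by (intro sum.cong refl) (simp only: orth lessThan_iff if_distrib[of "\<lambda>x. x * _"] mult_zero_left)
  also have "\<dots> = complex_of_real (real N * (\<Sum>p<N. (cmod (a p))\<^sup>2))"
    unfolding of_real_mult of_real_sum complex_norm_square by (simp add: sum_distrib_left)
  finally show ?thesis by (simp only: of_real_eq_iff)
qed

lemma norm_vec_power2: "(norm (x :: 'a::real_normed_vector ^ 'n))\<^sup>2 = (\<Sum>i\<in>UNIV. (norm (x $ i))\<^sup>2)"
  by (simp add: norm_vec_def L2_set_def sum_nonneg)

text \<open>
  The vectors on the left are the first \<open>M\<close> coefficients of the product of \<open>\<Sum>\<^sub>j A\<^sub>j z\<^sup>j\<close> with
  \<open>\<Sum>\<^sub>p e\<^sub>p z\<^sup>p\<close>.  Parseval's identity turns the pointwise bound on the circle into a bound for all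
  coefficients of the product; the ones of index \<open>M\<close> and above are then dropped.
\<close>
lemma analytic_toeplitz_contractive:
  fixes A :: "nat \<Rightarrow> complex ^ 'k ^ 'k" and e :: "nat \<Rightarrow> complex ^ 'k"
  assumes contr: "\<And>z v. cmod z = 1 \<Longrightarrow> norm ((\<Sum>j\<le>d. z ^ j *\<^sub>C A j) *v v) \<le> norm v"
  shows "(\<Sum>p<M. (norm (\<Sum>j\<le>min d p. A j *v e (p - j)))\<^sup>2) \<le> (\<Sum>p<M. (norm (e p))\<^sup>2)"
proof -
  \<comment> \<open>There are more sample points than coefficients of the product, so no aliasing occurs.\<close>
  define N where "N = M + d + 1"
  define \<omega> where "\<omega> t = cis (2 * pi * real t / real N)" for t
  define f where "f p = (if p < M then e p else 0)" for p
  define g where "g p = (\<Sum>j\<le>min d p. A j *v f (p - j))" for p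
  have N: "N > 0" "M \<le> N" by (simp_all add: N_def)
  have parseval: "(\<Sum>t<N. (norm (\<Sum>p<N. \<omega> t ^ p *\<^sub>C h p))\<^sup>2) = real N * (\<Sum>p<N. (norm (h p))\<^sup>2)"
    for h :: "nat \<Rightarrow> complex ^ 'k"
  proof -
    have "(\<Sum>t<N. (norm (\<Sum>p<N. \<omega> t ^ p *\<^sub>C h p))\<^sup>2)
        = (\<Sum>i\<in>UNIV. \<Sum>t<N. (cmod (\<Sum>p<N. \<omega> t ^ p * h p $ i))\<^sup>2)"
      by (subst sum.swap) (simp add: norm_vec_power2 scaleC_vec_def scaleC_complex_def)
    also have "\<dots> = real N * (\<Sum>p<N. (norm (h p))\<^sup>2)"
      unfolding \<omega>_def parseval_roots_of_unity[OF N(1)] norm_vec_power2 sum_distrib_left[symmetric]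
      by (subst sum.swap) (rule refl)
    finally show ?thesis .
  qed
  have scale_mult: "(a *\<^sub>C C) *v v = a *\<^sub>C (C *v v)" "C *v (a *\<^sub>C v) = a *\<^sub>C (C *v v)"
    for a and C :: "complex ^ 'k ^ 'k" and v
    by (simp_all add: vec_eq_iff matrix_vector_mult_def scaleC_vec_def scaleC_complex_def
        sum_distrib_left mult_ac)
  have sum_mult: "(\<Sum>j\<in>J. C j) *v v = (\<Sum>j\<in>J. C j *v v)"
    for J and C :: "nat \<Rightarrow> complex ^ 'k ^ 'k" and v
    by (induction J rule: infinite_finite_induct)
      (simp_all add: matrix_vector_mult_add_rdistrib)
  have mult_sum: "C *v (\<Sum>j\<in>J. u j) = (\<Sum>j\<in>J. C *v u j)"
    for J and C :: "complex ^ 'k ^ 'k" and u :: "nat \<Rightarrow> complex ^ 'k"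
    by (induction J rule: infinite_finite_induct)
      (simp_all add: matrix_vector_right_distrib)
  have product: "(\<Sum>j\<le>d. z ^ j *\<^sub>C A j) *v (\<Sum>p<N. z ^ p *\<^sub>C f p) = (\<Sum>p<N. z ^ p *\<^sub>C g p)" for z
  proof -
    have shift: "z ^ j *\<^sub>C (A j *v (\<Sum>p<N. z ^ p *\<^sub>C f p))
        = (\<Sum>p<N. if j \<le> p then z ^ p *\<^sub>C (A j *v f (p - j)) else 0)" if "j \<le> d" for j
    proof -
      have "z ^ j *\<^sub>C (A j *v (\<Sum>p<N. z ^ p *\<^sub>C f p)) = (\<Sum>p<N. z ^ (p + j) *\<^sub>C (A j *v f p))"
        unfolding mult_sum scaleC_sum scale_mult scaleC_scaleC by (simp add: power_add mult.commute)
      also have "\<dots> = (\<Sum>p<N - j. z ^ (p + j) *\<^sub>C (A j *v f p))"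
        using that by (intro sum.mono_neutral_right) (auto simp: f_def N_def scaleC_zero)
      also have "\<dots> = (\<Sum>p\<in>{j..<N}. z ^ p *\<^sub>C (A j *v f (p - j)))"
        using that
        by (intro sum.reindex_bij_witness[of _ "\<lambda>p. p - j" "\<lambda>p. p + j"]) (auto simp: N_def)
      also have "\<dots> = (\<Sum>p<N. if j \<le> p then z ^ p *\<^sub>C (A j *v f (p - j)) else 0)"
        by (intro sum.mono_neutral_cong_left) auto
      finally show ?thesis .
    qed
    have "(\<Sum>j\<le>d. z ^ j *\<^sub>C A j) *v (\<Sum>p<N. z ^ p *\<^sub>C f p)
        = (\<Sum>j\<le>d. \<Sum>p<N. if j \<le> p then z ^ p *\<^sub>C (A j *v f (p - j)) else 0)"
      unfolding sum_mult scale_mult by (intro sum.cong) (auto simp: shift)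
    also have "\<dots> = (\<Sum>p<N. \<Sum>j\<le>d. if j \<le> p then z ^ p *\<^sub>C (A j *v f (p - j)) else 0)"
      by (rule sum.swap)
    also have "\<dots> = (\<Sum>p<N. z ^ p *\<^sub>C g p)"
      unfolding g_def scaleC_sum
      by (intro sum.cong refl sum.mono_neutral_cong_right) auto
    finally show ?thesis .
  qed
  have "(\<Sum>p<M. (norm (\<Sum>j\<le>min d p. A j *v e (p - j)))\<^sup>2) = (\<Sum>p<M. (norm (g p))\<^sup>2)"
    by (auto simp: g_def f_def intro!: sum.cong arg_cong[of _ _ norm])
  also have "\<dots> \<le> (\<Sum>p<N. (norm (g p))\<^sup>2)"
    using N by (intro sum_mono2) auto
  also have "real N * \<dots> \<le> real N * (\<Sum>p<N. (norm (f p))\<^sup>2)"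
    unfolding parseval[symmetric] product[symmetric]
    by (intro sum_mono power_mono contr) (auto simp: \<omega>_def)
  then have "(\<Sum>p<N. (norm (g p))\<^sup>2) \<le> (\<Sum>p<N. (norm (f p))\<^sup>2)"
    using N by simp
  also have "\<dots> = (\<Sum>p<M. (norm (e p))\<^sup>2)"
    using N by (intro sum.mono_neutral_cong_right) (auto simp: f_def)
  finally show ?thesis .
qed

text \<open>
  Reversing the order of the vectors (\<open>s \<mapsto> M - 1 - s\<close>) exchanges this upper triangular block
  Toeplitz matrix with the lower triangular one of a multiplication operator.
\<close>
lemma backward_toeplitz_contractive:
  fixes A :: "nat \<Rightarrow> complex ^ 'k ^ 'k" and w :: "nat \<Rightarrow> complex ^ 'k"
  assumes contr: "\<And>z v. cmod z = 1 \<Longrightarrow> norm ((\<Sum>j\<le>d. z ^ j *\<^sub>C A j) *v v) \<le> norm v"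
    and zero: "\<And>m. m \<ge> M \<Longrightarrow> w m = 0"
  shows "(\<Sum>s<M. (norm (\<Sum>j\<le>d. A j *v w (s + j)))\<^sup>2) \<le> (\<Sum>s<M. (norm (w s))\<^sup>2)"
proof -
  have "(\<Sum>j\<le>d. A j *v w (s + j))
      = (\<Sum>j\<le>min d (M - Suc s). A j *v w (M - Suc (M - Suc s - j)))" if "s < M" for s
  proof (rule sum.mono_neutral_cong_right)
    show "\<forall>j\<in>{..d} - {..min d (M - Suc s)}. A j *v w (s + j) = 0"
    proof
      fix j assume "j \<in> {..d} - {..min d (M - Suc s)}"
      then have "w (s + j) = 0" using that by (intro zero) auto
      then show "A j *v w (s + j) = 0" by simp
    qed
  qed (use that in auto)
  then have "(\<Sum>s<M. (norm (\<Sum>j\<le>d. A j *v w (s + j)))\<^sup>2)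
      = (\<Sum>s<M. (norm (\<Sum>j\<le>min d (M - Suc s). A j *v w (M - Suc (M - Suc s - j))))\<^sup>2)"
    by simp
  also have "\<dots> = (\<Sum>p<M. (norm (\<Sum>j\<le>min d p. A j *v w (M - Suc (p - j))))\<^sup>2)"
    by (rule sum.nat_diff_reindex)
  also have "\<dots> \<le> (\<Sum>p<M. (norm (w (M - Suc p)))\<^sup>2)"
    by (rule analytic_toeplitz_contractive[OF contr])
  also have "\<dots> = (\<Sum>s<M. (norm (w s))\<^sup>2)"
    by (rule sum.nat_diff_reindex)
  finally show ?thesis .
qed

section \<open>Coordinates for the defect form\<close>

definition defect_form :: "('v::complex_inner \<Rightarrow> 'v) \<Rightarrow> 'v \<Rightarrow> 'v \<Rightarrow> complex"
  where "defect_form T u v = cinner u v - cinner (T u) (T v)"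

lemma cinner_sum_sum:
  fixes u v :: "'i \<Rightarrow> 'v::complex_inner"
  shows "cinner (\<Sum>x\<in>F. c x *\<^sub>C u x) (\<Sum>y\<in>F'. b y *\<^sub>C v y)
    = (\<Sum>x\<in>F. \<Sum>y\<in>F'. c x * cnj (b y) * cinner (u x) (v y))"
proof -
  have left: "cinner (\<Sum>x\<in>F. c x *\<^sub>C u x) z = (\<Sum>x\<in>F. c x * cinner (u x) z)"
    for F c z and u :: "'i \<Rightarrow> 'v"
    by (induction F rule: infinite_finite_induct)
      (simp_all add: cinner_add_left cinner_scaleC_left
        cinner_scaleC_left[of 0 "0::'v", unfolded scaleC_zero, simplified])
  have right: "cinner z (\<Sum>y\<in>F. c y *\<^sub>C u y) = (\<Sum>y\<in>F. cnj (c y) * cinner z (u y))"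
    for F c z and u :: "'i \<Rightarrow> 'v"
    by (subst cinner_commute, subst left)
      (auto intro!: sum.cong simp flip: cinner_commute)
  show ?thesis
    unfolding left unfolding right by (simp only: sum_distrib_left mult.assoc)
qed

lemma bounded_clinear_sum:
  assumes "bounded_clinear T"
  shows "T (\<Sum>x\<in>F. c x *\<^sub>C u x) = (\<Sum>x\<in>F. c x *\<^sub>C T (u x))"
  using assms linear_sum[OF bounded_linear.linear, of T "\<lambda>x. c x *\<^sub>C u x" F]
  by (simp add: bounded_clinear_def)

lemma defect_form_sum:
  fixes T :: "'v::complex_inner \<Rightarrow> 'v" and u :: "'i \<Rightarrow> 'v"
  assumes "bounded_clinear T"
  shows "defect_form T (\<Sum>x\<in>F. c x *\<^sub>C u x) (\<Sum>x\<in>F. c x *\<^sub>C u x)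
    = (\<Sum>x\<in>F. \<Sum>y\<in>F. c x * cnj (c y) * defect_form T (u x) (u y))"
  by (simp add: defect_form_def bounded_clinear_sum[OF assms] cinner_sum_sum
      algebra_simps sum_subtractf)

lemma defect_form_self:
  fixes T :: "'v::complex_inner \<Rightarrow> 'v"
  shows "defect_form T u u = of_real ((norm u)\<^sup>2 - (norm (T u))\<^sup>2)"
  by (simp add: defect_form_def cinner_self)

text \<open>
  The numbers \<open>B r x\<close> are coordinates of the vectors \<open>u x\<close> in which \<open>D\<close> becomes the standard
  inner product.  The map \<open>f\<close> allows linear combinations of any subfamily, with repetitions, such
  as the images of a given combination under powers of \<open>T\<close>.
\<close>
lemma defect_coordinates:
  fixes T :: "'v::complex_inner \<Rightarrow> 'v" and u :: "'i \<Rightarrow> 'v"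
  assumes T: "bounded_clinear T" and contr: "\<And>v. norm (T v) \<le> norm v" and S: "finite S"
  shows "\<exists>B :: 'i \<Rightarrow> 'i \<Rightarrow> complex. \<forall>(J :: 'j set) f c. f ` J \<subseteq> S \<longrightarrow>
      (let x = (\<Sum>j\<in>J. c j *\<^sub>C u (f j)) in (norm x)\<^sup>2 - (norm (T x))\<^sup>2)
        = (\<Sum>r\<in>S. (cmod (\<Sum>j\<in>J. c j * B r (f j)))\<^sup>2)"
proof -
  define G where "G x y = defect_form T (u x) (u y)" for x y
  have "\<exists>B. \<forall>x\<in>S. \<forall>y\<in>S. G x y = (\<Sum>r\<in>S. B r x * cnj (B r y))"
  proof (rule psd_matrix_is_gram[OF S])
    show "G y x = cnj (G x y)" for x y
      by (simp add: G_def defect_form_def flip: cinner_commute)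
    show "0 \<le> Re (\<Sum>x\<in>S. \<Sum>y\<in>S. c x * cnj (c y) * G x y)" for c
      unfolding G_def defect_form_sum[OF T, symmetric] defect_form_self
      using power_mono[OF contr norm_ge_zero] by simp
  qed
  then obtain B where B: "\<And>x y. x \<in> S \<Longrightarrow> y \<in> S \<Longrightarrow> G x y = (\<Sum>r\<in>S. B r x * cnj (B r y))"
    by blast
  have "(let x = (\<Sum>j\<in>J. c j *\<^sub>C u (f j)) in (norm x)\<^sup>2 - (norm (T x))\<^sup>2)
        = (\<Sum>r\<in>S. (cmod (\<Sum>j\<in>J. c j * B r (f j)))\<^sup>2)"
    if "f ` J \<subseteq> S" for J :: "'j set" and f c
  proof -
    let ?x = "\<Sum>j\<in>J. c j *\<^sub>C u (f j)"
    have "complex_of_real ((norm ?x)\<^sup>2 - (norm (T ?x))\<^sup>2)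
        = (\<Sum>i\<in>J. \<Sum>j\<in>J. c i * cnj (c j) * G (f i) (f j))"
      unfolding defect_form_self[symmetric] defect_form_sum[OF T] G_def ..
    also have "\<dots> = (\<Sum>i\<in>J. \<Sum>j\<in>J. \<Sum>r\<in>S. (c i * B r (f i)) * cnj (c j * B r (f j)))"
      using that by (intro sum.cong refl) (auto simp: B image_subset_iff sum_distrib_left mult_ac)
    also have "\<dots> = (\<Sum>r\<in>S. \<Sum>i\<in>J. \<Sum>j\<in>J. (c i * B r (f i)) * cnj (c j * B r (f j)))"
      by (subst (2) sum.swap, subst sum.swap, rule refl)
    also have "\<dots> = complex_of_real (\<Sum>r\<in>S. (cmod (\<Sum>j\<in>J. c j * B r (f j)))\<^sup>2)"
      unfolding of_real_sum complex_norm_square cnj_sum sum_product ..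
    finally show ?thesis by (simp only: of_real_eq_iff Let_def)
  qed
  then show ?thesis by blast
qed

section \<open>The von Neumann inequality for nilpotent contractions\<close>

lemma norm_power2_telescope:
  fixes T :: "'v::real_normed_vector \<Rightarrow> 'v"
  assumes "(T ^^ M) x = 0"
  shows "(norm x)\<^sup>2 = (\<Sum>s<M. (norm ((T ^^ s) x))\<^sup>2 - (norm (T ((T ^^ s) x)))\<^sup>2)"
  using sum_lessThan_telescope'[of "\<lambda>s. (norm ((T ^^ s) x))\<^sup>2" M] assms by simp

text \<open>
  In each coordinate \<open>r\<close> of the defect form the vectors \<open>T\<^sup>my\<^sub>l\<close> become vectors \<open>w r m\<close> in \<open>\<complex>\<^sup>k\<close>,
  and applying \<open>T\<close> shifts \<open>m\<close>.  Summing the Toeplitz inequality over \<open>r\<close> gives the claim,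
  because telescoping recovers \<open>\<parallel>P(T)y\<parallel>\<^sup>2\<close> on the left and \<open>\<parallel>y\<parallel>\<^sup>2\<close> on the right.
\<close>
theorem von_neumann_matrix_nilpotent:
  fixes T :: "'v::complex_inner \<Rightarrow> 'v" and P :: "(complex ^ 'k ^ 'k) poly"
  assumes T: "bounded_clinear T" and contr: "\<And>v. norm (T v) \<le> norm v"
    and nil: "\<And>v. (T ^^ M) v = 0"
    and P: "\<And>z v. cmod z = 1 \<Longrightarrow> norm (mpoly_eval P z *v v) \<le> norm v"
  shows "norm (mpoly_op P T y) \<le> norm y"
proof -
  define d where "d = degree P"
  \<comment> \<open>The exponents \<open>s + j\<close> with \<open>s < M\<close> and \<open>j \<le> d\<close> must all be indices.\<close>
  define S :: "(nat \<times> 'k) set" where "S = {..<M + d + 1} \<times> UNIV"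
  define u where "u x = (T ^^ fst x) (y $ snd x)" for x :: "nat \<times> 'k"
  obtain B :: "nat \<times> 'k \<Rightarrow> nat \<times> 'k \<Rightarrow> complex" where B:
    "\<And>(J :: (nat \<times> 'k) set) f c. f ` J \<subseteq> S \<Longrightarrow>
      (let x = (\<Sum>j\<in>J. c j *\<^sub>C u (f j)) in (norm x)\<^sup>2 - (norm (T x))\<^sup>2)
        = (\<Sum>r\<in>S. (cmod (\<Sum>j\<in>J. c j * B r (f j)))\<^sup>2)"
  proof -
    have "finite S" by (simp add: S_def)
    from defect_coordinates[OF T contr this, of u, where ?'j = "nat \<times> 'k"] that
    show thesis by blast
  qed
  define w where "w r m = (if m < M then (\<chi> l. B r (m, l)) else 0)" for r m
  have T0: "T 0 = 0" using contr[of 0] by simp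
  have u_defect: "(norm (u x))\<^sup>2 - (norm (T (u x)))\<^sup>2 = (\<Sum>r\<in>S. (cmod (B r x))\<^sup>2)" if "x \<in> S" for x
    using B[of "\<lambda>_. x" "{undefined}" "\<lambda>_. 1"] that scaleC_of_real[of 1 "u x"] by (simp add: Let_def)
  have u_zero: "u (m, l) = 0" if "m \<ge> M" for m l
  proof -
    have "(T ^^ m) v = (T ^^ (m - M)) ((T ^^ M) v)" for v
      using that by (simp flip: comp_apply[of "T ^^ (m - M)"] funpow_add)
    moreover have "(T ^^ n) 0 = 0" for n by (induction n) (simp_all add: T0)
    ultimately show ?thesis by (simp add: u_def nil)
  qed
  \<comment> \<open>The cut-off at \<open>M\<close> in \<open>w\<close> loses nothing: coordinates of a zero vector vanish.\<close>
  have w_nth: "w r m $ l = B r (m, l)" if "r \<in> S" "(m, l) \<in> S" for r m l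
  proof (cases "m < M")
    case False
    then have "(\<Sum>r\<in>S. (cmod (B r (m, l)))\<^sup>2) = 0"
      using u_defect[OF that(2)] u_zero by (simp add: T0)
    then have "B r (m, l) = 0"
      using that(1) by (subst (asm) sum_nonneg_eq_0_iff) (auto simp: S_def)
    then show ?thesis using False by (simp add: w_def)
  qed (simp add: w_def)
  have entry: "(T ^^ s) (mpoly_op P T y $ i)
      = (\<Sum>(j, l)\<in>{..d} \<times> UNIV. coeff P j $ i $ l *\<^sub>C u (s + j, l))" for s i
  proof -
    have "mpoly_op P T y $ i = (\<Sum>x\<in>{..d} \<times> UNIV. coeff P (fst x) $ i $ snd x *\<^sub>C u x)"
      by (simp add: mpoly_op_def mat_tensor_def d_def u_def sum.cartesian_product case_prod_beta)
    then show ?thesis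
      by (simp add: bounded_clinear_sum[OF bounded_clinear_funpow[OF T]] u_def case_prod_beta
          funpow_add)
  qed
  have coord: "(\<Sum>(j, l)\<in>{..d} \<times> UNIV. coeff P j $ i $ l * B r (s + j, l))
      = (\<Sum>j\<le>d. coeff P j *v w r (s + j)) $ i" if "r \<in> S" "s < M" for r s i
    using that
    by (auto simp: sum.cartesian_product[symmetric] matrix_vector_mult_def S_def w_nth
        intro!: sum.cong)
  have defect: "(norm ((T ^^ s) (mpoly_op P T y $ i)))\<^sup>2 - (norm (T ((T ^^ s) (mpoly_op P T y $ i))))\<^sup>2
      = (\<Sum>r\<in>S. (cmod ((\<Sum>j\<le>d. coeff P j *v w r (s + j)) $ i))\<^sup>2)" if "s < M" for s i
  proof -
    have "(\<lambda>(j, l). (s + j, l)) ` ({..d} \<times> UNIV) \<subseteq> S"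
      using that by (auto simp: S_def)
    from B[OF this, of "\<lambda>(j, l). coeff P j $ i $ l"] show ?thesis
      using coord[OF _ that] by (simp add: entry case_prod_beta Let_def)
  qed
  have swap3: "(\<Sum>i\<in>I. \<Sum>s\<in>J. \<Sum>r\<in>R. h i s r) = (\<Sum>r\<in>R. \<Sum>s\<in>J. \<Sum>i\<in>I. h i s r)"
    for I :: "'k set" and J :: "nat set" and R :: "(nat \<times> 'k) set" and h :: "_ \<Rightarrow> _ \<Rightarrow> _ \<Rightarrow> real"
    by (rule trans[OF sum.cong[OF refl sum.swap] trans[OF sum.swap sum.cong[OF refl sum.swap]]])
  have "(norm (mpoly_op P T y))\<^sup>2
      = (\<Sum>i\<in>UNIV. \<Sum>s<M. \<Sum>r\<in>S. (cmod ((\<Sum>j\<le>d. coeff P j *v w r (s + j)) $ i))\<^sup>2)"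
    unfolding norm_vec_power2
    by (intro sum.cong refl trans[OF norm_power2_telescope[OF nil]]) (simp add: defect)
  also have "\<dots> = (\<Sum>r\<in>S. \<Sum>s<M. (norm (\<Sum>j\<le>d. coeff P j *v w r (s + j)))\<^sup>2)"
    unfolding norm_vec_power2
    by (rule swap3)
  also have "\<dots> \<le> (\<Sum>r\<in>S. \<Sum>s<M. (norm (w r s))\<^sup>2)"
    using P by (intro sum_mono backward_toeplitz_contractive) (auto simp: w_def mpoly_eval_def d_def)
  also have "\<dots> = (\<Sum>l\<in>UNIV. \<Sum>s<M. \<Sum>r\<in>S. (cmod (B r (s, l)))\<^sup>2)"
    unfolding norm_vec_power2 by (subst swap3) (simp add: w_def)
  also have "\<dots> = (\<Sum>l\<in>UNIV. \<Sum>s<M. (norm (u (s, l)))\<^sup>2 - (norm (T (u (s, l))))\<^sup>2)"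
    by (intro sum.cong refl u_defect[symmetric]) (auto simp: S_def)
  also have "\<dots> = (norm y)\<^sup>2"
    unfolding norm_vec_power2[of y]
    by (intro sum.cong refl trans[OF _ norm_power2_telescope[OF nil, symmetric]]) (simp add: u_def)
  finally show ?thesis by (rule power2_le_imp_le) simp
qed

section \<open>Varopoulos operators\<close>

lemma contractive_on_closed_disc:
  fixes P :: "(complex ^ 'k ^ 'k) poly"
  assumes "(SUP z\<in>ball 0 1. mat_opnorm (mpoly_eval P z)) \<le> 1" and "cmod z \<le> 1"
  shows "norm (mpoly_eval P z *v v) \<le> norm v"
proof (rule continuous_on_closure_norm_le[where s = "ball 0 1" and f = "\<lambda>z. mpoly_eval P z *v v"])
  have eval: "mpoly_eval P z *v v
      = (\<chi> i. \<Sum>l\<in>UNIV. (\<Sum>j\<le>degree P. z ^ j * coeff P j $ i $ l) * v $ l)" for z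
    by (simp add: mpoly_eval_def matrix_vector_mult_def scaleC_vec_def scaleC_complex_def)
  show "continuous_on (closure (ball 0 1)) (\<lambda>z. mpoly_eval P z *v v)"
    unfolding eval by (intro continuous_intros)
  show "\<forall>z\<in>ball 0 1. norm (mpoly_eval P z *v v) \<le> norm v"
  proof
    fix z :: complex assume "z \<in> ball 0 1"
    then have "mat_opnorm (mpoly_eval P z) \<le> 1"
      using cSUP_upper[OF _ bdd_above_mat_opnorm_mpoly_eval[of P]] assms(1) by (meson order_trans)
    then have "mat_opnorm (mpoly_eval P z) * norm v \<le> norm v"
      by (simp add: mult_left_le_one_le mat_opnorm_def onorm_pos_le bounded_linear_mat_vec)
    then show "norm (mpoly_eval P z *v v) \<le> norm v"
      using onorm[OF bounded_linear_mat_vec, of "mpoly_eval P z" v] by (simp add: mat_opnorm_def)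
  qed
  show "z \<in> closure (ball 0 1)" using assms(2) by simp
qed

theorem theorem3p5:
  fixes X :: "'h::complex_hilbert_space \<Rightarrow> 'h"
    and P :: "(complex ^ 'k ^ 'k) poly"
    and n :: nat
  assumes "separable_space (euclidean :: 'h topology)"
    and "bounded_clinear X" and "onorm X \<le> 1"
    and "degree P \<le> n"
    and "(SUP z\<in>ball 0 1. mat_opnorm (mpoly_eval P z)) \<le> 1"
  shows "onorm (mpoly_op P (varopoulos_op X)) \<le> 1"
proof -
  have lin: "bounded_linear X" using assms(2) by (simp add: bounded_clinear_def)
  have X: "norm (X v) \<le> norm v" for v
  proof -
    have "norm (X v) \<le> onorm X * norm v" by (rule onorm[OF lin])
    also have "\<dots> \<le> norm v" using assms(3) by (simp add: mult_left_le_one_le onorm_pos_le lin)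
    finally show ?thesis .
  qed
  have contr: "norm (varopoulos_op X v) \<le> norm v" for v
  proof (rule power2_le_imp_le)
    have "(norm (X (v $ 2)))\<^sup>2 \<le> (norm (v $ 2))\<^sup>2" "(norm (X (v $ 3)))\<^sup>2 \<le> (norm (v $ 3))\<^sup>2"
      by (simp_all add: power_mono X)
    then show "(norm (varopoulos_op X v))\<^sup>2 \<le> (norm v)\<^sup>2"
      by (simp add: norm_vec_power2 sum_3 varopoulos_op_def add_increasing add_mono)
  qed simp
  have nil: "(varopoulos_op X ^^ 3) v = 0" for v
    using X[of 0]
    by (simp add: numeral_3_eq_3 varopoulos_op_def vec_eq_iff forall_3)
  have "norm (mpoly_op P (varopoulos_op X) y) \<le> norm y" for y
    by (rule von_neumann_matrix_nilpotent[where M = 3])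
      (use assms contr nil in \<open>auto intro: bounded_clinear_varopoulos_op contractive_on_closed_disc\<close>)
  then show ?thesis by (intro onorm_bound) auto
qed

end
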